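(* Let $1\le p<q<\infty$. If a closed ideal of $L(\ell_p,\ell_q)$ contains a non-compact operator, then it contains $\mathcal J^{I_{p,q}}$, the closed ideal of $L(\ell_p,\ell_q)$ generated by the formal identity operator $I_{p,q}\colon\ell_p\to\ell_q$.
   Context: $L(X,Y)$ is the space of bounded linear operators from $X$ to $Y$, and $L(X)=L(X,X)$. An ideal in $L(\ell_p,\ell_q)$ is a linear subspace $\mathcal J\subseteq L(\ell_p,\ell_q)$ such that $ATB\in\mathcal J$ whenever $A\in L(\ell_q)$, $T\in\mathcal J$, $B\in L(\ell_p)$; it is closed if it is closed in the operator norm. The closed ideal generated by $S\in L(\ell_p,\ell_q)$ is the smallest closed ideal containing $S$. The formal identity $I_{p,q}$ is $x\mapsto x$. *)

theory Defs
  imports "HOL-Analysis.Analysis" "HOL-Library.Function_Algebras"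
begin

text \<open>
  The scalar field is a type \<open>'a\<close> of class \<open>real_normed_field\<close>; together with
  \<open>euclidean_space\<close> this covers exactly the real and the complex case.
  Sequence spaces are carrier sets of functions \<open>nat \<Rightarrow> 'a\<close>, with
  the pointwise vector space operations.
\<close>

definition ell :: "real \<Rightarrow> (nat \<Rightarrow> 'a::real_normed_field) set" where
  "ell p = {x. summable (\<lambda>n. norm (x n) powr p)}"

definition ell_norm :: "real \<Rightarrow> (nat \<Rightarrow> 'a::real_normed_field) \<Rightarrow> real" where
  "ell_norm p x = (\<Sum>n. norm (x n) powr p) powr (1 / p)"

definition ell_topology :: "real \<Rightarrow> (nat \<Rightarrow> 'a::real_normed_field) topology" where
  "ell_topology p = Metric_space.mtopology (ell p) (\<lambda>x y. ell_norm p (x - y))"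

text \<open>
  An operator on \<open>ell p\<close> is represented by the function that agrees with it on \<open>ell p\<close> and
  is \<open>0\<close> elsewhere. This makes the representation unique, and the
  vector space operations and the composition of operators are the pointwise operations and
  the composition of functions.
\<close>

type_synonym 'a seq_op = "(nat \<Rightarrow> 'a) \<Rightarrow> (nat \<Rightarrow> 'a)"

definition bdd_ops :: "real \<Rightarrow> real \<Rightarrow> 'a::real_normed_field seq_op set" where
  "bdd_ops p q = {T.
     (\<forall>x\<in>ell p. T x \<in> ell q) \<and>
     (\<forall>x. x \<notin> ell p \<longrightarrow> T x = 0) \<and>
     (\<forall>x\<in>ell p. \<forall>y\<in>ell p. T (x + y) = T x + T y) \<and>
     (\<forall>c. \<forall>x\<in>ell p. T (\<lambda>n. c * x n) = (\<lambda>n. c * T x n)) \<and>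
     (\<exists>C. \<forall>x\<in>ell p. ell_norm q (T x) \<le> C * ell_norm p x)}"

text \<open>
  The value \<open>0\<close> outside \<open>bdd_ops\<close> only makes the distance below nonnegative
  on the whole type, as the locale \<open>Metric_space\<close> demands.
\<close>

definition op_norm :: "real \<Rightarrow> real \<Rightarrow> 'a::real_normed_field seq_op \<Rightarrow> real" where
  "op_norm p q T =
     (if T \<in> bdd_ops p q
      then SUP x\<in>{x\<in>ell p. ell_norm p x \<le> 1}. ell_norm q (T x) else 0)"

definition op_topology :: "real \<Rightarrow> real \<Rightarrow> 'a::real_normed_field seq_op topology" where
  "op_topology p q = Metric_space.mtopology (bdd_ops p q) (\<lambda>S T. op_norm p q (S - T))"

definition compact_op :: "real \<Rightarrow> real \<Rightarrow> 'a::real_normed_field seq_op \<Rightarrow> bool" where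
  "compact_op p q T \<longleftrightarrow> T \<in> bdd_ops p q \<and>
     compactin (ell_topology q)
       (ell_topology q closure_of (T ` {x\<in>ell p. ell_norm p x \<le> 1}))"

definition op_ideal :: "real \<Rightarrow> real \<Rightarrow> 'a::real_normed_field seq_op set \<Rightarrow> bool" where
  "op_ideal p q J \<longleftrightarrow>
     J \<subseteq> bdd_ops p q \<and>
     0 \<in> J \<and>
     (\<forall>S\<in>J. \<forall>T\<in>J. S + T \<in> J) \<and>
     (\<forall>c. \<forall>T\<in>J. (\<lambda>x n. c * T x n) \<in> J) \<and>
     (\<forall>A\<in>bdd_ops q q. \<forall>T\<in>J. \<forall>B\<in>bdd_ops p p. A \<circ> T \<circ> B \<in> J)"

definition closed_op_ideal :: "real \<Rightarrow> real \<Rightarrow> 'a::real_normed_field seq_op set \<Rightarrow> bool" where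
  "closed_op_ideal p q J \<longleftrightarrow> op_ideal p q J \<and> closedin (op_topology p q) J"

definition closed_ideal_generated ::
    "real \<Rightarrow> real \<Rightarrow> 'a::real_normed_field seq_op \<Rightarrow> 'a seq_op set" where
  "closed_ideal_generated p q S = closed_op_ideal p q hull {S}"

definition formal_identity :: "real \<Rightarrow> 'a::real_normed_field seq_op" where
  "formal_identity p = (\<lambda>x. if x \<in> ell p then x else 0)"

text \<open>
  For \<open>1 \<le> p\<close> and \<open>1 \<le> q\<close> the distances used above are metrics, \<open>bdd_ops p q\<close> is itself a
  closed ideal, and \<open>closed_ideal_generated p q S\<close> is the smallest closed ideal containing \<open>S\<close>.
\<close>

lemma powr_convex_nonneg:
  fixes a b :: real
  assumes p: "1 \<le> p" and "0 \<le> a" "0 \<le> b" "0 < u" "0 < v" "u + v = 1"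
  shows "(u * a + v * b) powr p \<le> u * a powr p + v * b powr p"
proof -
  have small: "(w * c) powr p \<le> w * c powr p" if "0 < w" "w \<le> 1" "0 \<le> c" for w c :: real
  proof -
    have "w powr p \<le> w powr 1"
      using that p by (intro powr_mono') auto
    then show ?thesis
      using that by (simp add: powr_mult mult_right_mono)
  qed
  consider "a = 0" | "b = 0" | "0 < a" "0 < b"
    using assms by fastforce
  then show ?thesis
  proof cases
    case 3
    have "(\<lambda>x. x powr p) (u *\<^sub>R a + v *\<^sub>R b) \<le> u * a powr p + v * b powr p"
      using powr_convex[OF p] 3 assms unfolding convex_on_def by auto
    then show ?thesis by simp
  qed (use small[of u a] small[of v b] assms in auto)
qed

lemma ell_norm_nonneg [simp]: "0 \<le> ell_norm p x"
  by (simp add: ell_norm_def)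

lemma zero_in_ell [simp]: "0 \<in> ell p"
  by (simp add: ell_def)

lemma ell_norm_zero [simp]: "ell_norm p 0 = 0"
  by (simp add: ell_norm_def)

lemma ell_norm_powr:
  assumes "x \<in> ell p" "1 \<le> p"
  shows "ell_norm p x powr p = (\<Sum>n. norm (x n) powr p)"
  using assms by (simp add: ell_norm_def ell_def powr_powr suminf_nonneg)

lemma powr_le_iff:
  fixes a b p :: real
  assumes "1 \<le> p" "0 \<le> a" "0 \<le> b"
  shows "a powr p \<le> b powr p \<longleftrightarrow> a \<le> b"
proof
  assume le: "a powr p \<le> b powr p"
  show "a \<le> b"
  proof (rule ccontr)
    assume "\<not> a \<le> b"
    then have "b powr p < a powr p"
      using assms by (intro powr_less_mono2) auto
    with le show False by simp
  qed
next
  assume "a \<le> b"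
  then show "a powr p \<le> b powr p"
    using assms by (intro powr_mono2) auto
qed

lemma ell_norm_le_iff:
  assumes "x \<in> ell p" "1 \<le> p" "0 \<le> r"
  shows "ell_norm p x \<le> r \<longleftrightarrow> (\<Sum>n. norm (x n) powr p) \<le> r powr p"
  using powr_le_iff[OF assms(2) ell_norm_nonneg[of p x] assms(3)] ell_norm_powr[OF assms(1,2)] by simp

lemma norm_le_ell_norm:
  assumes x: "x \<in> ell p" and p: "1 \<le> p"
  shows "norm (x n) \<le> ell_norm p x"
proof -
  have "norm (x n) powr p \<le> (\<Sum>n. norm (x n) powr p)"
    using sum_le_suminf[of "\<lambda>n. norm (x n) powr p" "{n}"] x by (simp add: ell_def)
  also have "\<dots> = ell_norm p x powr p"
    using ell_norm_powr[OF x p] by simp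
  finally show ?thesis
    using powr_le_iff[OF p norm_ge_zero ell_norm_nonneg] by blast
qed

lemma ell_norm_eq_0_iff:
  assumes "x \<in> ell p" "1 \<le> p"
  shows "ell_norm p x = 0 \<longleftrightarrow> x = 0"
  using norm_le_ell_norm[OF assms] by (fastforce simp: fun_eq_iff)

lemma ell_scale:
  assumes x: "x \<in> ell p" and p: "1 \<le> p"
  shows "(\<lambda>n. c * x n) \<in> ell p" and "ell_norm p (\<lambda>n. c * x n) = norm c * ell_norm p x"
proof -
  have s: "summable (\<lambda>n. norm (x n) powr p)" using x by (simp add: ell_def)
  have e: "norm (c * x n) powr p = norm c powr p * norm (x n) powr p" for n
    by (simp add: norm_mult powr_mult)
  show "(\<lambda>n. c * x n) \<in> ell p" using s by (simp add: ell_def e summable_mult)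
  show "ell_norm p (\<lambda>n. c * x n) = norm c * ell_norm p x"
    using s p by (simp add: ell_norm_def e suminf_mult powr_mult powr_powr suminf_nonneg)
qed

lemma ell_add:
  assumes x: "x \<in> ell p" and y: "y \<in> ell p" and p: "1 \<le> p"
  shows "x + y \<in> ell p" and "ell_norm p (x + y) \<le> ell_norm p x + ell_norm p y"
proof -
  have "x + y \<in> ell p \<and> ell_norm p (x + y) \<le> ell_norm p x + ell_norm p y"
  proof (cases "x = 0 \<or> y = 0")
    case True
    then show ?thesis using x y by auto
  next
    case False
    define s t where "s = ell_norm p x" and "t = ell_norm p y"
    have st: "0 < s" "0 < t"
      using False x y p ell_norm_eq_0_iff ell_norm_nonneg unfolding s_def t_def
      by (metis order_le_less)+
    define u v where "u = s / (s + t)" and "v = t / (s + t)"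
    have uv: "0 < u" "0 < v" "u + v = 1"
      using st by (auto simp: u_def v_def simp flip: add_divide_distrib)
    define f g where "f n = norm (x n) powr p / s powr p" and "g n = norm (y n) powr p / t powr p" for n
    have unit: "(\<lambda>n. norm (z n) powr p / ell_norm p z powr p) sums 1"
      if "z \<in> ell p" "0 < ell_norm p z" for z :: "nat \<Rightarrow> 'a"
      using sums_divide[OF summable_sums, of "\<lambda>n. norm (z n) powr p" "ell_norm p z powr p"] that
        ell_norm_powr[OF that(1) p, symmetric] by (simp add: ell_def)
    have sums: "f sums 1" "g sums 1"
      using unit[OF x] unit[OF y] st by (simp_all add: f_def[abs_def] g_def[abs_def] s_def t_def)
    have le: "norm ((x + y) n) powr p \<le> (s + t) powr p * (u * f n + v * g n)" for n
    proof -
      have "norm ((x + y) n) \<le> (s + t) * (u * (norm (x n) / s) + v * (norm (y n) / t))"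
      proof -
        have "(s + t) * (u * (norm (x n) / s)) = norm (x n)" "(s + t) * (v * (norm (y n) / t)) = norm (y n)"
          using st by (simp_all add: u_def v_def)
        then show ?thesis
          using norm_triangle_ineq[of "x n" "y n"] by (simp add: distrib_left)
      qed
      then have "norm ((x + y) n) powr p \<le> ((s + t) * (u * (norm (x n) / s) + v * (norm (y n) / t))) powr p"
        using p by (intro powr_mono2) auto
      also have "\<dots> = (s + t) powr p * (u * (norm (x n) / s) + v * (norm (y n) / t)) powr p"
        using st uv by (simp add: powr_mult)
      also have "\<dots> \<le> (s + t) powr p * (u * (norm (x n) / s) powr p + v * (norm (y n) / t) powr p)"
        using st uv p by (intro mult_left_mono powr_convex_nonneg) auto
      finally show ?thesis
        using st by (simp add: f_def g_def powr_divide)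
    qed
    have S: "(\<lambda>n. (s + t) powr p * (u * f n + v * g n)) sums ((s + t) powr p * (u * 1 + v * 1))"
      by (intro sums_mult sums_add sums)
    have summ: "summable (\<lambda>n. norm ((x + y) n) powr p)"
      by (rule summable_comparison_test'[OF sums_summable[OF S], of 0]) (use le in auto)
    then have in_ell: "x + y \<in> ell p" by (simp add: ell_def)
    have "(\<Sum>n. norm ((x + y) n) powr p) \<le> (s + t) powr p"
      using suminf_le[OF le summ sums_summable[OF S]] sums_unique[OF S] uv by simp
    then have "ell_norm p (x + y) \<le> s + t"
      using ell_norm_le_iff[OF in_ell p, of "s + t"] st by simp
    with in_ell show ?thesis by (simp add: s_def t_def)
  qed
  then show "x + y \<in> ell p" "ell_norm p (x + y) \<le> ell_norm p x + ell_norm p y" by auto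
qed

lemma ell_minus:
  assumes x: "x \<in> ell p"
  shows "- x \<in> ell p" and "ell_norm p (- x) = ell_norm p x"
  using assms by (simp_all add: ell_def ell_norm_def)

lemma ell_diff:
  assumes x: "x \<in> ell p" and y: "y \<in> ell p" and p: "1 \<le> p"
  shows "x - y \<in> ell p"
  using ell_add(1)[OF x ell_minus(1)[OF y] p] by simp

lemma ell_norm_minus_commute: "ell_norm p (x - y) = ell_norm p (y - x)"
  by (simp add: ell_norm_def norm_minus_commute)

lemma Metric_space_ell:
  assumes p: "1 \<le> p"
  shows "Metric_space (ell p) (\<lambda>x y. ell_norm p (x - y))"
proof
  fix x y z :: "nat \<Rightarrow> 'a"
  show "ell_norm p (x - y) = ell_norm p (y - x)" by (rule ell_norm_minus_commute)
  assume x: "x \<in> ell p" and y: "y \<in> ell p"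
  show "ell_norm p (x - y) = 0 \<longleftrightarrow> x = y"
    using ell_norm_eq_0_iff[OF ell_diff[OF x y p] p] by simp
  assume z: "z \<in> ell p"
  show "ell_norm p (x - z) \<le> ell_norm p (x - y) + ell_norm p (y - z)"
    using ell_add(2)[OF ell_diff[OF x y p] ell_diff[OF y z p] p] by simp
qed simp

lemma bdd_opsD:
  assumes "T \<in> bdd_ops p q"
  shows "x \<in> ell p \<Longrightarrow> T x \<in> ell q" "x \<notin> ell p \<Longrightarrow> T x = 0"
    "x \<in> ell p \<Longrightarrow> y \<in> ell p \<Longrightarrow> T (x + y) = T x + T y"
    "x \<in> ell p \<Longrightarrow> T (\<lambda>n. c * x n) = (\<lambda>n. c * T x n)"
    "\<exists>C\<ge>0. \<forall>x\<in>ell p. ell_norm q (T x) \<le> C * ell_norm p x"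
proof -
  obtain C where C: "\<forall>x\<in>ell p. ell_norm q (T x) \<le> C * ell_norm p x"
    using assms by (auto simp: bdd_ops_def)
  have "ell_norm q (T x) \<le> max 0 C * ell_norm p x" if "x \<in> ell p" for x
    using C[rule_format, OF that] mult_right_mono[of C "max 0 C" "ell_norm p x"] by simp
  then show "\<exists>C\<ge>0. \<forall>x\<in>ell p. ell_norm q (T x) \<le> C * ell_norm p x"
    by (meson max.cobounded1)
qed (use assms in \<open>auto simp: bdd_ops_def\<close>)

lemma bdd_opsI:
  assumes "\<And>x. x \<in> ell p \<Longrightarrow> T x \<in> ell q"
    and "\<And>x. x \<notin> ell p \<Longrightarrow> T x = 0"
    and "\<And>x y. x \<in> ell p \<Longrightarrow> y \<in> ell p \<Longrightarrow> T (x + y) = T x + T y"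
    and "\<And>c x. x \<in> ell p \<Longrightarrow> T (\<lambda>n. c * x n) = (\<lambda>n. c * T x n)"
    and "\<And>x. x \<in> ell p \<Longrightarrow> ell_norm q (T x) \<le> C * ell_norm p x"
  shows "T \<in> bdd_ops p q"
  unfolding bdd_ops_def using assms by blast

lemma bdd_ops_apply_zero:
  assumes "T \<in> bdd_ops p q"
  shows "T 0 = 0"
proof -
  have "T (0 + 0) = T 0 + T 0" by (rule bdd_opsD(3)[OF assms]) auto
  then show ?thesis by simp
qed

lemma bdd_ops_zero [simp]: "0 \<in> bdd_ops p q"
  by (auto simp: bdd_ops_def fun_eq_iff intro!: exI[of _ 0])

lemma bdd_ops_add:
  assumes S: "S \<in> bdd_ops p q" and T: "T \<in> bdd_ops p q" and q: "1 \<le> q"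
  shows "S + T \<in> bdd_ops p q"
proof -
  obtain C D where C: "\<forall>x\<in>ell p. ell_norm q (S x) \<le> C * ell_norm p x"
    and D: "\<forall>x\<in>ell p. ell_norm q (T x) \<le> D * ell_norm p x"
    using S T by (auto simp: bdd_ops_def)
  have "ell_norm q ((S + T) x) \<le> (C + D) * ell_norm p x" if x: "x \<in> ell p" for x
    using ell_add(2)[OF bdd_opsD(1)[OF S x] bdd_opsD(1)[OF T x] q] C[rule_format, OF x]
      D[rule_format, OF x] by (simp add: distrib_right)
  then show ?thesis
    using ell_add(1)[OF bdd_opsD(1)[OF S] bdd_opsD(1)[OF T] q]
    by (intro bdd_opsI[where C = "C + D"])
      (simp_all add: bdd_opsD(2-4)[OF S] bdd_opsD(2-4)[OF T] fun_eq_iff algebra_simps)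
qed

lemma bdd_ops_scale:
  assumes T: "T \<in> bdd_ops p q" and q: "1 \<le> q"
  shows "(\<lambda>x n. c * T x n) \<in> bdd_ops p q"
proof -
  obtain D where D: "\<forall>x\<in>ell p. ell_norm q (T x) \<le> D * ell_norm p x"
    using T by (auto simp: bdd_ops_def)
  have "ell_norm q (\<lambda>n. c * T x n) \<le> (norm c * D) * ell_norm p x" if x: "x \<in> ell p" for x
    using ell_scale(2)[OF bdd_opsD(1)[OF T x] q] D[rule_format, OF x]
    by (simp add: mult.assoc mult_left_mono)
  then show ?thesis
    using ell_scale(1)[OF bdd_opsD(1)[OF T] q]
    by (intro bdd_opsI[where C = "norm c * D"])
      (simp_all add: bdd_opsD(2-4)[OF T] fun_eq_iff algebra_simps)
qed

lemma bdd_ops_comp: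
  assumes S: "S \<in> bdd_ops q r" and T: "T \<in> bdd_ops p q"
  shows "S \<circ> T \<in> bdd_ops p r"
proof -
  obtain C D where C: "C \<ge> 0" "\<forall>x\<in>ell q. ell_norm r (S x) \<le> C * ell_norm q x"
    and D: "\<forall>x\<in>ell p. ell_norm q (T x) \<le> D * ell_norm p x"
    using bdd_opsD(5)[OF S] bdd_opsD(5)[OF T] by auto
  have "ell_norm r (S (T x)) \<le> (C * D) * ell_norm p x" if x: "x \<in> ell p" for x
  proof -
    have "ell_norm r (S (T x)) \<le> C * ell_norm q (T x)"
      using C(2) bdd_opsD(1)[OF T x] by blast
    also have "\<dots> \<le> C * (D * ell_norm p x)"
      using C D x by (intro mult_left_mono) auto
    finally show ?thesis by (simp add: mult.assoc)
  qed
  moreover have "S 0 = 0"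
    by (rule bdd_ops_apply_zero[OF S])
  ultimately show ?thesis
    using bdd_opsD[OF S] bdd_opsD[OF T] by (auto simp: bdd_ops_def)
qed

lemma bdd_ops_diff:
  assumes "S \<in> bdd_ops p q" and "T \<in> bdd_ops p q" and "1 \<le> q"
  shows "S - T \<in> bdd_ops p q"
proof -
  have "S - T = S + (\<lambda>x n. - 1 * T x n)" by (simp add: fun_eq_iff)
  then show ?thesis using bdd_ops_add[OF assms(1) bdd_ops_scale[OF assms(2,3)] assms(3)] by metis
qed

lemma op_norm_bdd_above:
  assumes "T \<in> bdd_ops p q"
  shows "bdd_above ((\<lambda>x. ell_norm q (T x)) ` {x\<in>ell p. ell_norm p x \<le> 1})"
proof -
  obtain C where C: "C \<ge> 0" "\<forall>x\<in>ell p. ell_norm q (T x) \<le> C * ell_norm p x"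
    using bdd_opsD(5)[OF assms] by auto
  have "ell_norm q (T x) \<le> C" if "x \<in> ell p" "ell_norm p x \<le> 1" for x
    using C that mult_left_mono[of "ell_norm p x" 1 C] by fastforce
  then show ?thesis by (auto intro!: bdd_aboveI)
qed

lemma op_norm_upper:
  assumes "T \<in> bdd_ops p q" "x \<in> ell p" "ell_norm p x \<le> 1"
  shows "ell_norm q (T x) \<le> op_norm p q T"
proof -
  have "ell_norm q (T x) \<le> (SUP x\<in>{x\<in>ell p. ell_norm p x \<le> 1}. ell_norm q (T x))"
    using assms op_norm_bdd_above by (intro cSUP_upper) auto
  then show ?thesis using assms by (simp add: op_norm_def)
qed

lemma op_norm_least:
  assumes "\<And>x. x \<in> ell p \<Longrightarrow> ell_norm p x \<le> 1 \<Longrightarrow> ell_norm q (T x) \<le> C"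
    and "T \<in> bdd_ops p q"
  shows "op_norm p q T \<le> C"
proof -
  have "{x\<in>ell p. ell_norm p x \<le> 1} \<noteq> {}" by (auto intro!: exI[of _ 0])
  then have "(SUP x\<in>{x\<in>ell p. ell_norm p x \<le> 1}. ell_norm q (T x)) \<le> C"
    using assms by (intro cSUP_least) auto
  then show ?thesis using assms by (simp add: op_norm_def)
qed

lemma op_norm_nonneg [simp]: "0 \<le> op_norm p q T"
proof (cases "T \<in> bdd_ops p q")
  case True
  have "ell_norm q (T 0) \<le> op_norm p q T" using op_norm_upper[OF True zero_in_ell] by simp
  then show ?thesis using ell_norm_nonneg[of q "T 0"] by linarith
qed (simp add: op_norm_def)

lemma op_norm_bound:
  assumes T: "T \<in> bdd_ops p q" and x: "x \<in> ell p" and pq: "1 \<le> p" "1 \<le> q"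
  shows "ell_norm q (T x) \<le> op_norm p q T * ell_norm p x"
proof (cases "x = 0")
  case True
  moreover have "T 0 = 0"
    by (rule bdd_ops_apply_zero[OF T])
  ultimately show ?thesis by simp
next
  case False
  define s where "s = ell_norm p x"
  have s: "s > 0" using False ell_norm_eq_0_iff[OF x pq(1)] ell_norm_nonneg[of p x] unfolding s_def by linarith
  define c :: 'a where "c = of_real (1 / s)"
  have "ell_norm p (\<lambda>n. c * x n) = 1"
    using s ell_scale(2)[OF x pq(1), of c] by (simp add: c_def norm_divide s_def)
  then have "ell_norm q (T (\<lambda>n. c * x n)) \<le> op_norm p q T"
    using op_norm_upper[OF T ell_scale(1)[OF x pq(1)]] by simp
  moreover have "ell_norm q (T (\<lambda>n. c * x n)) = (1 / s) * ell_norm q (T x)"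
    using s ell_scale(2)[OF bdd_opsD(1)[OF T x] pq(2), of c] bdd_opsD(4)[OF T x, of c]
    by (simp add: c_def norm_divide)
  ultimately show ?thesis using s by (simp add: s_def field_simps)
qed

lemma Metric_space_bdd_ops:
  assumes pq: "1 \<le> p" "1 \<le> q"
  shows "Metric_space (bdd_ops p q) (\<lambda>S T. op_norm p q (S - T))"
proof
  fix S T U :: "'a seq_op"
  have m: "- V \<in> bdd_ops p q" if "V \<in> bdd_ops p q" for V :: "'a seq_op"
    using bdd_ops_diff[OF bdd_ops_zero that pq(2)] by simp
  have mm: "S - T \<in> bdd_ops p q \<longleftrightarrow> T - S \<in> bdd_ops p q"
    using m[of "S - T"] m[of "T - S"] by auto
  then show "op_norm p q (S - T) = op_norm p q (T - S)"
    by (simp add: op_norm_def ell_norm_minus_commute[of q "S _"])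
  assume S: "S \<in> bdd_ops p q" and T: "T \<in> bdd_ops p q"
  have ST: "S - T \<in> bdd_ops p q" by (rule bdd_ops_diff[OF S T pq(2)])
  show "op_norm p q (S - T) = 0 \<longleftrightarrow> S = T"
  proof
    assume 0: "op_norm p q (S - T) = 0"
    have "(S - T) x = 0" for x
    proof (cases "x \<in> ell p")
      case True
      then have "ell_norm q ((S - T) x) = 0"
        using op_norm_bound[OF ST True pq] ell_norm_nonneg[of q "(S - T) x"]
        unfolding 0 by linarith
      then show ?thesis using ell_norm_eq_0_iff[OF bdd_opsD(1)[OF ST True] pq(2)] by blast
    qed (rule bdd_opsD(2)[OF ST])
    then show "S = T" by (simp add: fun_eq_iff)
  next
    assume "S = T"
    then have "op_norm p q (S - T) \<le> 0" by (intro op_norm_least) auto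
    then show "op_norm p q (S - T) = 0" using op_norm_nonneg[of p q "S - T"] by linarith
  qed
  assume U: "U \<in> bdd_ops p q"
  have TU: "T - U \<in> bdd_ops p q" by (rule bdd_ops_diff[OF T U pq(2)])
  show "op_norm p q (S - U) \<le> op_norm p q (S - T) + op_norm p q (T - U)"
  proof (rule op_norm_least)
    fix x :: "nat \<Rightarrow> 'a"
    assume x: "x \<in> ell p" "ell_norm p x \<le> 1"
    have "ell_norm q ((S - U) x) \<le> ell_norm q ((S - T) x) + ell_norm q ((T - U) x)"
      using ell_add(2)[OF bdd_opsD(1)[OF ST x(1)] bdd_opsD(1)[OF TU x(1)] pq(2)] by simp
    then show "ell_norm q ((S - U) x) \<le> op_norm p q (S - T) + op_norm p q (T - U)"
      using op_norm_upper[OF ST x] op_norm_upper[OF TU x] by linarith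
  qed (rule bdd_ops_diff[OF S U pq(2)])
qed simp

lemma formal_identity_bdd_ops:
  assumes p: "1 \<le> p" and pq: "p \<le> q"
  shows "formal_identity p \<in> bdd_ops p q"
proof -
  have main: "x \<in> ell q \<and> ell_norm q x \<le> ell_norm p x" if x: "x \<in> ell p" for x :: "nat \<Rightarrow> 'a"
  proof -
    let ?s = "ell_norm p x"
    have le: "norm (x n) powr q \<le> ?s powr (q - p) * norm (x n) powr p" for n
    proof -
      have "norm (x n) powr q = norm (x n) powr (q - p) * norm (x n) powr p"
        by (simp flip: powr_add)
      also have "\<dots> \<le> ?s powr (q - p) * norm (x n) powr p"
        using pq norm_le_ell_norm[OF x p] by (intro mult_right_mono powr_mono2) auto
      finally show ?thesis .
    qed
    have s: "summable (\<lambda>n. norm (x n) powr p)" using x by (simp add: ell_def)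
    have s': "summable (\<lambda>n. norm (x n) powr q)"
      by (rule summable_comparison_test'[OF summable_mult[OF s, of "?s powr (q - p)"], of 0])
        (use le in auto)
    then have xq: "x \<in> ell q" by (simp add: ell_def)
    have "(\<Sum>n. norm (x n) powr q) \<le> ?s powr (q - p) * (\<Sum>n. norm (x n) powr p)"
      using suminf_le[OF le s' summable_mult[OF s]] suminf_mult[OF s] by metis
    also have "\<dots> = ?s powr q" by (simp add: ell_norm_powr[OF x p, symmetric] flip: powr_add)
    finally show ?thesis
      using ell_norm_le_iff[OF xq _ ell_norm_nonneg[of p x]] p pq xq by simp
  qed
  show ?thesis
  proof (rule bdd_opsI[where C = 1])
    fix x y :: "nat \<Rightarrow> 'a" assume xy: "x \<in> ell p" "y \<in> ell p"
    show "formal_identity p (x + y) = formal_identity p x + formal_identity p y"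
      using xy ell_add(1)[OF xy p] by (simp add: formal_identity_def)
  next
    fix c and x :: "nat \<Rightarrow> 'a" assume x: "x \<in> ell p"
    show "formal_identity p (\<lambda>n. c * x n) = (\<lambda>n. c * formal_identity p x n)"
      using x ell_scale(1)[OF x p] by (simp add: formal_identity_def)
  qed (use main in \<open>simp_all add: formal_identity_def\<close>)
qed

lemma closed_op_ideal_bdd_ops:
  assumes "1 \<le> p" "1 \<le> q"
  shows "closed_op_ideal p q (bdd_ops p q)"
proof -
  interpret Metric_space "bdd_ops p q" "\<lambda>S T. op_norm p q (S - T)"
    by (rule Metric_space_bdd_ops[OF assms])
  show ?thesis
    using assms bdd_ops_add bdd_ops_scale bdd_ops_comp closedin_topspace[of mtopology]
    unfolding closed_op_ideal_def op_ideal_def op_topology_def by (auto intro!: bdd_ops_comp)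
qed

lemma closed_ideal_generated_closed_op_ideal:
  assumes "1 \<le> p" "1 \<le> q" "S \<in> bdd_ops p q"
  shows "closed_op_ideal p q (closed_ideal_generated p q S)"
proof -
  let ?F = "{J. closed_op_ideal p q J \<and> {S} \<subseteq> J}"
  have ne: "bdd_ops p q \<in> ?F"
    using assms closed_op_ideal_bdd_ops by auto
  then have "closedin (op_topology p q) (\<Inter>?F)"
    by (intro closedin_Inter) (auto simp: closed_op_ideal_def)
  moreover have "op_ideal p q (\<Inter>?F)"
    unfolding op_ideal_def using ne
    by (intro conjI ballI allI) (auto simp: closed_op_ideal_def op_ideal_def)
  ultimately show ?thesis
    unfolding closed_ideal_generated_def hull_def closed_op_ideal_def by simp
qed

end

theory Submission
  imports Defs
begin

text \<open>
  A non-compact operator \<open>T\<close> from \<open>\<ell>\<^sub>p\<close> to \<open>\<ell>\<^sub>q\<close> is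
  non-compact along a block sequence: there are vectors \<open>u\<^sub>k\<close>, bounded in \<open>\<ell>\<^sub>p\<close> and
  supported in consecutive intervals of indices, such that \<open>T u\<^sub>k\<close> is, up to an error as small
  as desired, supported in the same interval as \<open>u\<^sub>k\<close> and has norm bounded below
  (\<open>noncompact_op_localized\<close>). The reason is that compactness can fail only far out: the unit
  ball contains points whose images are uniformly separated from any given finite set of images,
  while finitely many coordinates of \<open>x\<close> and of \<open>T x\<close> take, up to a small error, finitely many
  values. Hence two points of the ball agree nearly on these coordinates and still have
  images far apart, and their difference lives far out. Since the argument rests on the
  boundedness of the coordinate functionals, it is the same for all \<open>p \<ge> 1\<close>.

  In \<open>\<ell>\<^sub>p\<close> a bounded block sequence is dominated by the unit vectors, so
  \<open>B: e\<^sub>k \<mapsto> u\<^sub>k\<close> defines a bounded operator on \<open>\<ell>\<^sub>p\<close> (\<open>block_synthesis\<close>). In \<open>\<ell>\<^sub>q\<close>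
  the functionals that norm the blocks of \<open>T u\<^sub>k\<close> assemble to a bounded operator \<open>A\<close> on
  \<open>\<ell>\<^sub>q\<close> that maps the \<open>k\<close>-th block to \<open>e\<^sub>k\<close> (\<open>block_analysis\<close>). Therefore \<open>A T B e\<^sub>k\<close>
  differs from \<open>e\<^sub>k\<close> by an error that can be prescribed for each \<open>k\<close> beforehand.

  An operator on \<open>\<ell>\<^sub>p\<close> has norm at most the sum of the norms of its values at the unit
  vectors (\<open>op_norm_le_unit_seqs\<close>). So the operators \<open>A T B\<close> come arbitrarily close to the
  formal identity. They belong to every ideal that contains \<open>T\<close>, and a closed ideal contains their
  limit.
\<close>

section \<open>Truncations and unit vectors\<close>

definition trunc :: "nat set \<Rightarrow> (nat \<Rightarrow> 'a::zero) \<Rightarrow> nat \<Rightarrow> 'a" where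
  "trunc S x = (\<lambda>n. if n \<in> S then x n else 0)"

definition unit_seq :: "nat \<Rightarrow> nat \<Rightarrow> 'a::zero_neq_one" where
  "unit_seq k = (\<lambda>n. if n = k then 1 else 0)"

lemma ell_sum_le:
  assumes "x \<in> ell p" "1 \<le> p" "finite F"
  shows "(\<Sum>n\<in>F. norm (x n) powr p) \<le> ell_norm p x powr p"
  using assms by (auto simp: ell_norm_powr ell_def intro!: sum_le_suminf)

text \<open>
  Bounds on a cofinal set of partial sums are enough. This suits sums over blocks of indices,
  which are controlled only at the end points of the blocks.
\<close>

lemma ell_boundedI:
  assumes p: "1 \<le> p" and C: "0 \<le> C"
    and le: "\<And>m. \<exists>m'\<ge>m. (\<Sum>n<m'. norm (x n) powr p) \<le> C powr p"
  shows "x \<in> ell p" and "ell_norm p x \<le> C"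
proof -
  have le': "(\<Sum>n<m. norm (x n) powr p) \<le> C powr p" for m
  proof -
    obtain m' where "m' \<ge> m" "(\<Sum>n<m'. norm (x n) powr p) \<le> C powr p"
      using le by blast
    moreover have "(\<Sum>n<m. norm (x n) powr p) \<le> (\<Sum>n<m'. norm (x n) powr p)"
      using \<open>m' \<ge> m\<close> by (intro sum_mono2) auto
    ultimately show ?thesis by linarith
  qed
  have s: "summable (\<lambda>n. norm (x n) powr p)"
    by (rule summableI_nonneg_bounded[OF _ le']) simp
  then show x: "x \<in> ell p" by (simp add: ell_def)
  show "ell_norm p x \<le> C"
    using ell_norm_le_iff[OF x p C] suminf_le_const[OF s le'] by simp
qed

lemma trunc_ell:
  assumes x: "x \<in> ell p" and p: "1 \<le> p"
  shows "trunc S x \<in> ell p" and "ell_norm p (trunc S x) \<le> ell_norm p x"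
proof -
  have "(\<Sum>n<m. norm (trunc S x n) powr p) \<le> ell_norm p x powr p" for m
  proof -
    have "(\<Sum>n<m. norm (trunc S x n) powr p) \<le> (\<Sum>n<m. norm (x n) powr p)"
      by (intro sum_mono) (simp add: trunc_def)
    also have "\<dots> \<le> ell_norm p x powr p"
      using ell_sum_le[OF x p] by simp
    finally show ?thesis .
  qed
  then show "trunc S x \<in> ell p" and "ell_norm p (trunc S x) \<le> ell_norm p x"
    using ell_boundedI[OF p, of "ell_norm p x" "trunc S x"] by auto
qed

lemma trunc_finite_ell:
  assumes "finite S" "1 \<le> p"
  shows "trunc S x \<in> ell p"
    and "ell_norm p (trunc S x) powr p = (\<Sum>n\<in>S. norm (x n) powr p)"
proof -
  have "(\<lambda>n. norm (trunc S x n) powr p) sums (\<Sum>n\<in>S. norm (trunc S x n) powr p)"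
    using assms by (intro sums_finite) (auto simp: trunc_def)
  then have *: "(\<lambda>n. norm (trunc S x n) powr p) sums (\<Sum>n\<in>S. norm (x n) powr p)"
    by (simp add: trunc_def cong: sum.cong)
  then show e: "trunc S x \<in> ell p" by (auto simp: ell_def sums_iff)
  show "ell_norm p (trunc S x) powr p = (\<Sum>n\<in>S. norm (x n) powr p)"
    using * by (simp add: ell_norm_powr[OF e assms(2)] sums_iff)
qed

lemma unit_seq_ell:
  assumes "1 \<le> p"
  shows "unit_seq k \<in> (ell p :: (nat \<Rightarrow> 'a::real_normed_field) set)"
    and "ell_norm p (unit_seq k :: nat \<Rightarrow> 'a) = 1"
proof -
  have "unit_seq k = trunc {k} (\<lambda>_. 1 :: 'a)"
    by (auto simp: unit_seq_def trunc_def)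
  with trunc_finite_ell[of "{k}" p "\<lambda>_. 1 :: 'a"] assms
  have *: "unit_seq k \<in> (ell p :: (nat \<Rightarrow> 'a) set)"
    "ell_norm p (unit_seq k :: nat \<Rightarrow> 'a) powr p = 1 powr p" by auto
  show "unit_seq k \<in> (ell p :: (nat \<Rightarrow> 'a) set)" by (rule *)
  have "ell_norm p (unit_seq k :: nat \<Rightarrow> 'a) = 1"
    using powr_le_iff[OF assms ell_norm_nonneg zero_le_one, of p "unit_seq k :: nat \<Rightarrow> 'a"]
      powr_le_iff[OF assms zero_le_one ell_norm_nonneg, of p "unit_seq k :: nat \<Rightarrow> 'a"] *
    by simp
  then show "ell_norm p (unit_seq k :: nat \<Rightarrow> 'a) = 1" .
qed

lemma trunc_Suc: "trunc {..<Suc N} x = trunc {..<N} x + (\<lambda>n. x N * unit_seq N n)"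
  for x :: "nat \<Rightarrow> 'a::real_normed_field"
  by (auto simp: trunc_def unit_seq_def fun_eq_iff less_Suc_eq)

lemma trunc_tail_small:
  assumes x: "x \<in> ell p" and p: "1 \<le> p" and e: "0 < e"
  obtains M where "\<And>m. M \<le> m \<Longrightarrow> ell_norm p (x - trunc {..<m} x) \<le> e"
proof -
  have "summable (\<lambda>n. norm (x n) powr p)" using x by (simp add: ell_def)
  then obtain M where M: "\<And>m n. M \<le> m \<Longrightarrow> norm (\<Sum>i=m..<n. norm (x i) powr p) < e powr p"
    unfolding summable_Cauchy using e by (metis powr_gt_zero less_irrefl)
  have "ell_norm p (x - trunc {..<m} x) \<le> e" if m: "M \<le> m" for m
  proof (rule ell_boundedI[OF p])
    fix k
    have "(\<Sum>n<max k m. norm ((x - trunc {..<m} x) n) powr p) = (\<Sum>i=m..<max k m. norm (x i) powr p)"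
      by (intro sum.mono_neutral_cong_right) (auto simp: trunc_def)
    then have "(\<Sum>n<max k m. norm ((x - trunc {..<m} x) n) powr p) \<le> e powr p"
      using M[OF m, of "max k m"] by simp
    then show "\<exists>m'\<ge>k. (\<Sum>n<m'. norm ((x - trunc {..<m} x) n) powr p) \<le> e powr p"
      by (intro exI[of _ "max k m"]) simp
  qed (use e in simp)
  then show ?thesis using that by blast
qed

lemma ell_norm_trunc_le:
  fixes x :: "nat \<Rightarrow> 'a::real_normed_field"
  assumes p: "1 \<le> p" and "\<And>n. n < N \<Longrightarrow> norm (x n) \<le> e"
  shows "ell_norm p (trunc {..<N} x) \<le> real N * e"
  using assms(2)
proof (induction N)
  case 0
  have "trunc {..<0} x = 0" by (simp add: trunc_def fun_eq_iff)
  then show ?case by (simp only: ell_norm_zero)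
next
  case (Suc N)
  have "ell_norm p (trunc {..<Suc N} x) \<le> ell_norm p (trunc {..<N} x) + norm (x N)"
  proof -
    have t: "trunc {..<N} x \<in> ell p" by (intro trunc_finite_ell p) simp
    have u: "unit_seq N \<in> (ell p :: (nat \<Rightarrow> 'a) set)" by (rule unit_seq_ell(1)[OF p])
    show ?thesis
      unfolding trunc_Suc using ell_add(2)[OF t ell_scale(1)[OF u p] p, of "x N"]
      by (simp add: ell_scale(2)[OF u p] unit_seq_ell(2)[OF p])
  qed
  also have "\<dots> \<le> real N * e + e"
    using Suc.IH Suc.prems by (intro add_mono) auto
  finally show ?case by (simp add: algebra_simps)
qed

lemma bdd_ops_apply_diff:
  assumes T: "T \<in> bdd_ops p q" and x: "x \<in> ell p" and y: "y \<in> ell p" and p: "1 \<le> p"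
  shows "T (x - y) = T x - T y"
  using bdd_opsD(3)[OF T ell_diff[OF x y p] y] by (simp add: algebra_simps)

section \<open>The operator norm and the unit vectors\<close>

text \<open>
  The coordinates of a vector in the unit ball have absolute value at most 1, so on truncations the
  claim is the triangle inequality. Truncations are dense because the exponent is finite.
\<close>

lemma op_norm_le_unit_seqs:
  assumes p: "1 \<le> p" and q: "1 \<le> q" and S: "S \<in> bdd_ops p q"
    and d: "\<And>k. ell_norm q (S (unit_seq k)) \<le> d k"
    and D: "\<And>K. (\<Sum>k<K. d k) \<le> D"
  shows "op_norm p q S \<le> D"
proof (rule op_norm_least[OF _ S])
  fix x :: "nat \<Rightarrow> 'a" assume x: "x \<in> ell p" "ell_norm p x \<le> 1"
  have x1: "norm (x n) \<le> 1" for n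
    using norm_le_ell_norm[OF x(1) p, of n] x(2) by linarith
  have fin: "ell_norm q (S (trunc {..<K} x)) \<le> (\<Sum>k<K. d k)" for K
  proof (induction K)
    case 0
    have "trunc {..<0} x = 0" by (simp add: trunc_def fun_eq_iff)
    then show ?case by (simp only: bdd_ops_apply_zero[OF S] ell_norm_zero) simp
  next
    case (Suc K)
    have u: "unit_seq K \<in> ell p" using unit_seq_ell(1)[OF p] .
    have eq: "S (trunc {..<Suc K} x) = S (trunc {..<K} x) + (\<lambda>n. x K * S (unit_seq K) n)"
      unfolding trunc_Suc bdd_opsD(4)[OF S u, symmetric]
      by (rule bdd_opsD(3)[OF S trunc_ell(1)[OF x(1) p] ell_scale(1)[OF u p]])
    have "ell_norm q (S (trunc {..<Suc K} x))
        \<le> ell_norm q (S (trunc {..<K} x)) + norm (x K) * ell_norm q (S (unit_seq K))"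
      unfolding eq
      using ell_add(2)[OF bdd_opsD(1)[OF S trunc_ell(1)[OF x(1) p]]
          ell_scale(1)[OF bdd_opsD(1)[OF S u] q] q] ell_scale(2)[OF bdd_opsD(1)[OF S u] q]
      by metis
    also have "norm (x K) * ell_norm q (S (unit_seq K)) \<le> 1 * d K"
      using x1 d by (intro mult_mono) auto
    finally show ?case using Suc by simp
  qed
  show "ell_norm q (S x) \<le> D"
  proof (rule field_le_epsilon)
    fix e :: real assume e: "0 < e"
    define r where "r = e / (op_norm p q S + 1)"
    have pos: "0 < op_norm p q S + 1"
      using op_norm_nonneg[of p q S] by linarith
    then have r: "0 < r" using e by (simp add: r_def)
    obtain M where M: "\<And>m. M \<le> m \<Longrightarrow> ell_norm p (x - trunc {..<m} x) \<le> r"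
      using trunc_tail_small[OF x(1) p r] by blast
    let ?t = "trunc {..<M} x"
    have t: "?t \<in> ell p" using trunc_ell(1)[OF x(1) p] .
    have xt: "x - ?t \<in> ell p" using ell_diff[OF x(1) t p] .
    have "S x = S ?t + S (x - ?t)"
      using bdd_opsD(3)[OF S t xt] by simp
    then have "ell_norm q (S x) \<le> ell_norm q (S ?t) + ell_norm q (S (x - ?t))"
      using ell_add(2)[OF bdd_opsD(1)[OF S t] bdd_opsD(1)[OF S xt] q] by simp
    moreover have "ell_norm q (S ?t) \<le> D"
      using fin[of M] D[of M] by linarith
    moreover have "ell_norm q (S (x - ?t)) \<le> e"
    proof -
      have "ell_norm q (S (x - ?t)) \<le> op_norm p q S * r"
        using op_norm_bound[OF S xt p q] mult_left_mono[OF M[of M], of "op_norm p q S"] by simp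
      also have "\<dots> \<le> (op_norm p q S + 1) * r"
        using r by (intro mult_right_mono) auto
      finally show ?thesis using pos by (simp add: r_def)
    qed
    ultimately show "ell_norm q (S x) \<le> D + e" by linarith
  qed
qed

section \<open>Non-compact operators\<close>

text \<open>
  In a complete space a totally bounded set has compact closure. Completeness is therefore what
  turns the failure of compactness into images that are separated by a fixed distance.
\<close>

lemma mcomplete_ell:
  assumes p: "1 \<le> p"
  shows "Metric_space.mcomplete (ell p :: (nat \<Rightarrow> 'a::{real_normed_field, banach}) set)
    (\<lambda>x y. ell_norm p (x - y))"
proof -
  interpret Metric_space "ell p :: (nat \<Rightarrow> 'a) set" "\<lambda>x y. ell_norm p (x - y)"
    by (rule Metric_space_ell[OF p])
  show ?thesis
    unfolding mcomplete_def
  proof (intro allI impI)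
    fix \<sigma> :: "nat \<Rightarrow> nat \<Rightarrow> 'a" assume \<sigma>: "MCauchy \<sigma>"
    then have in_ell: "\<sigma> n \<in> ell p" for n by (auto simp: MCauchy_def)
    have cau: "\<exists>N. \<forall>n n'. N \<le> n \<longrightarrow> N \<le> n' \<longrightarrow> ell_norm p (\<sigma> n - \<sigma> n') < e" if "e > 0" for e
      using \<sigma> that by (auto simp: MCauchy_def)
    have "Cauchy (\<lambda>n. \<sigma> n i)" for i
      unfolding Cauchy_def dist_norm
    proof (intro allI impI)
      fix e :: real assume "e > 0"
      then obtain N where "\<forall>n n'. N \<le> n \<longrightarrow> N \<le> n' \<longrightarrow> ell_norm p (\<sigma> n - \<sigma> n') < e"
        using cau by blast
      moreover have "norm (\<sigma> n i - \<sigma> n' i) \<le> ell_norm p (\<sigma> n - \<sigma> n')" for n n'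
        using norm_le_ell_norm[OF ell_diff[OF in_ell in_ell p] p, of n n' i] by simp
      ultimately show "\<exists>M. \<forall>m\<ge>M. \<forall>n\<ge>M. norm (\<sigma> m i - \<sigma> n i) < e"
        by (meson le_less_trans)
    qed
    then have "\<exists>l. (\<lambda>n. \<sigma> n i) \<longlonglongrightarrow> l" for i
      using Cauchy_convergent convergent_def by blast
    then obtain L where L: "\<And>i. (\<lambda>n. \<sigma> n i) \<longlonglongrightarrow> L i" by metis
    \<comment> \<open>The Cauchy estimate passes to the pointwise limit on finite partial sums.\<close>
    have close: "\<exists>N. \<forall>n\<ge>N. \<sigma> n - L \<in> ell p \<and> ell_norm p (\<sigma> n - L) \<le> e" if e: "e > 0" for e
    proof -
      obtain N where N: "\<And>n n'. N \<le> n \<Longrightarrow> N \<le> n' \<Longrightarrow> ell_norm p (\<sigma> n - \<sigma> n') < e"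
        using cau[OF e] by blast
      have "(\<Sum>i<K. norm ((\<sigma> n - L) i) powr p) \<le> e powr p" if n: "N \<le> n" for n K
      proof (rule LIMSEQ_le_const2)
        show "(\<lambda>n'. \<Sum>i<K. norm (\<sigma> n i - \<sigma> n' i) powr p) \<longlonglongrightarrow> (\<Sum>i<K. norm ((\<sigma> n - L) i) powr p)"
          using p unfolding fun_diff_def
          by (intro tendsto_sum tendsto_powr2 tendsto_norm tendsto_diff tendsto_const L) auto
        have "(\<Sum>i<K. norm (\<sigma> n i - \<sigma> n' i) powr p) \<le> e powr p" if n': "N \<le> n'" for n'
        proof -
          have "(\<Sum>i<K. norm (\<sigma> n i - \<sigma> n' i) powr p) \<le> ell_norm p (\<sigma> n - \<sigma> n') powr p"
            using ell_sum_le[OF ell_diff[OF in_ell in_ell p] p, of "{..<K}" n n'] by simp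
          also have "\<dots> \<le> e powr p"
            using N[OF n n'] p by (intro powr_mono2) auto
          finally show ?thesis .
        qed
        then show "\<exists>N. \<forall>n'\<ge>N. (\<Sum>i<K. norm (\<sigma> n i - \<sigma> n' i) powr p) \<le> e powr p" by blast
      qed
      then show ?thesis
        using ell_boundedI[OF p, of e] e by (metis less_imp_le order_refl)
    qed
    obtain N where "\<sigma> N - L \<in> ell p" using close[of 1] by auto
    then have Lell: "L \<in> ell p"
      using ell_diff[OF in_ell[of N] _ p, of "\<sigma> N - L"] by simp
    have "limitin mtopology \<sigma> L sequentially"
      unfolding limitin_metric
    proof (intro conjI allI impI Lell)
      fix e :: real assume "e > 0"
      then obtain N where "\<forall>n\<ge>N. ell_norm p (\<sigma> n - L) \<le> e / 2"
        using close[of "e / 2"] by auto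
      then show "\<forall>\<^sub>F n in sequentially. \<sigma> n \<in> ell p \<and> ell_norm p (\<sigma> n - L) < e"
        using in_ell \<open>e > 0\<close> unfolding eventually_sequentially
        by (intro exI[of _ N]) (fastforce)
    qed
    then show "\<exists>x. limitin mtopology \<sigma> x sequentially" by blast
  qed
qed

lemma noncompact_op_separated:
  fixes T :: "'a::{real_normed_field, euclidean_space} seq_op"
  assumes q: "1 \<le> q" and T: "T \<in> bdd_ops p q" and nc: "\<not> compact_op p q T"
  obtains e where "0 < e"
    and "\<And>F. finite F \<Longrightarrow> F \<subseteq> {x \<in> ell p. ell_norm p x \<le> 1} \<Longrightarrow>
      \<exists>x\<in>{x \<in> ell p. ell_norm p x \<le> 1}. \<forall>f\<in>F. e \<le> ell_norm q (T x - T f)"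
proof -
  interpret Metric_space "ell q :: (nat \<Rightarrow> 'a) set" "\<lambda>x y. ell_norm q (x - y)"
    by (rule Metric_space_ell[OF q])
  let ?B = "{x \<in> ell p. ell_norm p x \<le> 1} :: (nat \<Rightarrow> 'a) set"
  have sub: "T ` ?B \<subseteq> ell q" using bdd_opsD(1)[OF T] by auto
  have "\<not> mtotally_bounded (T ` ?B)"
    using nc T mtotally_bounded_eq_compact_closure_of[OF mcomplete_ell[OF q], of "T ` ?B"]
    by (auto simp: compact_op_def ell_topology_def)
  then obtain e where e: "0 < e"
    and ne: "\<nexists>K. finite K \<and> K \<subseteq> T ` ?B \<and> T ` ?B \<subseteq> (\<Union>x\<in>K. mball x e)"
    unfolding mtotally_bounded_def not_all not_imp by (elim exE conjE) (rule that)
  show thesis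
  proof (rule that[OF e])
    fix F assume F: "finite F" "F \<subseteq> ?B"
    then have "finite (T ` F) \<and> T ` F \<subseteq> T ` ?B" by (intro conjI finite_imageI image_mono)
    then have "\<not> T ` ?B \<subseteq> (\<Union>y\<in>T ` F. mball y e)"
      using ne by (intro notI) (elim notE conjE, intro exI conjI)
    then obtain z where z: "z \<in> T ` ?B" "z \<notin> (\<Union>y\<in>T ` F. mball y e)"
      unfolding subset_iff not_all not_imp by (elim exE conjE) (rule that)
    obtain x where x: "x \<in> ?B" "z = T x" using z(1) by (rule imageE)
    have "e \<le> ell_norm q (T x - T f)" if f: "f \<in> F" for f
    proof -
      have "T x \<in> ell q" "T f \<in> ell q" using sub x f F by auto
      moreover have "T x \<notin> mball (T f) e" using z(2) f unfolding x(2) by (meson UN_I imageI)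
      ultimately show ?thesis
        by (simp only: in_mball simp_thms not_less ell_norm_minus_commute[of q "T x"])
    qed
    then show "\<exists>x\<in>?B. \<forall>f\<in>F. e \<le> ell_norm q (T x - T f)" using x(1) by blast
  qed
qed

text \<open>
  Replacing each coordinate by a nearby point of a finite net of the ball of radius \<open>R\<close> leaves only
  finitely many patterns; \<open>F\<close> consists of one representative for each pattern that occurs.
\<close>

lemma finite_net_coordinates:
  fixes g :: "'b \<Rightarrow> 'i \<Rightarrow> 'a::euclidean_space"
  assumes I: "finite I" and R: "\<And>x i. x \<in> X \<Longrightarrow> i \<in> I \<Longrightarrow> norm (g x i) \<le> R" and e: "0 < e"
  obtains F where "finite F" "F \<subseteq> X" "\<And>x. x \<in> X \<Longrightarrow> \<exists>f\<in>F. \<forall>i\<in>I. norm (g x i - g f i) \<le> e"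
proof -
  have "e / 2 > 0" using e by simp
  then obtain C where C: "finite C" "cball 0 R \<subseteq> (\<Union>c\<in>C. ball (c::'a) (e / 2))"
    using compact_cball[of "0::'a" R] unfolding compact_eq_totally_bounded by meson
  have "\<exists>c\<in>C. norm (g x i - c) < e / 2" if "x \<in> X" "i \<in> I" for x i
    using C(2) R[OF that] by (auto simp: subset_iff dist_norm norm_minus_commute[of "g x i"])
  then obtain c where c: "\<And>x i. x \<in> X \<Longrightarrow> i \<in> I \<Longrightarrow> c x i \<in> C \<and> norm (g x i - c x i) < e / 2"
    by metis
  let ?h = "\<lambda>x. restrict (c x) I"
  have "?h ` X \<subseteq> PiE I (\<lambda>_. C)" using c by (auto simp: PiE_iff)
  then have "finite (?h ` X)"
    by (rule finite_subset) (intro finite_PiE I C(1))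
  then obtain F where F: "F \<subseteq> X" "finite F" "?h ` X = ?h ` F"
    using finite_subset_image[of "?h ` X" ?h X] by blast
  have "\<exists>f\<in>F. \<forall>i\<in>I. norm (g x i - g f i) \<le> e" if x: "x \<in> X" for x
  proof -
    obtain f where f: "f \<in> F" "?h x = ?h f" using F(3) x by blast
    have "norm (g x i - g f i) \<le> e" if i: "i \<in> I" for i
    proof -
      have "c x i = c f i" using fun_cong[OF f(2), of i] i by simp
      then have "norm (g x i - c x i) < e / 2" "norm (g f i - c x i) < e / 2"
        using c[OF x i] c[of f i] F(1) f(1) i by auto
      then show ?thesis
        using norm_triangle_ineq4[of "g x i - c x i" "g f i - c x i"] by simp
    qed
    with f(1) show ?thesis by blast
  qed
  with F show thesis using that by blast
qed

text \<open>
  The vector \<open>u\<close> is the difference \<open>y\<close> of two points of the unit ball that nearly agree, together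
  with their images, on the first \<open>N\<close> coordinates, cut off to finitely many coordinates from
  \<open>N\<close> on. Cutting off changes \<open>y\<close> by little, and so changes \<open>T y\<close> by little because
  \<open>T\<close> is bounded. The lower bound \<open>e\<close> is chosen before \<open>N\<close> and \<open>d\<close>, and this uniformity is what
  allows the lemma to be iterated.
\<close>

lemma noncompact_op_localized:
  fixes T :: "'a::{real_normed_field, euclidean_space} seq_op"
  assumes p: "1 \<le> p" and q: "1 \<le> q" and T: "T \<in> bdd_ops p q" and nc: "\<not> compact_op p q T"
  obtains e where "0 < e"
    and "\<And>N d. 0 < d \<Longrightarrow> \<exists>M>N. \<exists>u\<in>ell p. ell_norm p u \<le> 2 \<and>
      (\<forall>n. n \<notin> {N..<M} \<longrightarrow> u n = 0) \<and> e \<le> ell_norm q (trunc {N..<M} (T u)) \<and>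
      ell_norm q (T u - trunc {N..<M} (T u)) \<le> d"
proof -
  let ?B = "{x \<in> ell p. ell_norm p x \<le> 1} :: (nat \<Rightarrow> 'a) set"
  obtain e where e: "0 < e"
    and sep: "\<And>F. finite F \<Longrightarrow> F \<subseteq> ?B \<Longrightarrow> \<exists>x\<in>?B. \<forall>f\<in>F. e \<le> ell_norm q (T x - T f)"
    using noncompact_op_separated[OF q T nc] by blast
  have main: "\<exists>M>N. \<exists>u\<in>ell p. ell_norm p u \<le> 2 \<and>
      (\<forall>n. n \<notin> {N..<M} \<longrightarrow> u n = 0) \<and> e / 2 \<le> ell_norm q (trunc {N..<M} (T u)) \<and>
      ell_norm q (T u - trunc {N..<M} (T u)) \<le> d" if d: "0 < d" for N d
  proof -
    define C where "C = op_norm p q T"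
    have C: "0 \<le> C" by (simp add: C_def)
    have Tb: "ell_norm q (T x) \<le> C * ell_norm p x" if "x \<in> ell p" for x
      using op_norm_bound[OF T that p q] by (simp add: C_def)
    define d' where "d' = min d (e / 2)"
    have d': "0 < d'" "d' \<le> d" "d' \<le> e / 2" using d e by (auto simp: d'_def)
    \<comment> \<open>The tolerance for each coordinate: all errors below add up to at most \<open>d'\<close>.\<close>
    define h where "h = d' / (2 * (real N + 1) * (1 + C))"
    have h: "0 < h" using d' C by (simp add: h_def)
    have hd: "(real N + 1) * (1 + C) * h = d' / 2"
      using C by (simp add: h_def field_simps add_nonneg_eq_0_iff)
    \<comment> \<open>The flag selects between the coordinates of \<open>x\<close> and those of \<open>T x\<close>.\<close>
    define g where "g x i = (if fst i then x (snd i) else T x (snd i))" for x and i :: "bool \<times> nat"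
    have bnd: "norm (g x i) \<le> max 1 C" if "x \<in> ?B" for x i
    proof -
      have "norm (x (snd i)) \<le> 1"
        using norm_le_ell_norm[of x p "snd i"] p that by auto
      moreover have "norm (T x (snd i)) \<le> C"
        using norm_le_ell_norm[OF bdd_opsD(1)[OF T, of x] q, of "snd i"] op_norm_upper[OF T, of x] that
        by (auto simp: C_def)
      ultimately show ?thesis by (auto simp: g_def)
    qed
    have "finite (UNIV \<times> {..<N} :: (bool \<times> nat) set)" by simp
    then obtain F where F: "finite F" "F \<subseteq> ?B"
      and net: "\<And>x. x \<in> ?B \<Longrightarrow> \<exists>f\<in>F. \<forall>i\<in>UNIV \<times> {..<N}. norm (g x i - g f i) \<le> h"
      by (rule finite_net_coordinates[where X = ?B and g = g, OF _ bnd h]) (assumption, rule that)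
    obtain x where x: "x \<in> ?B" and far: "\<forall>f\<in>F. e \<le> ell_norm q (T x - T f)"
      using sep[OF F] by blast
    obtain f where f: "f \<in> F" and near: "\<forall>i\<in>UNIV \<times> {..<N}. norm (g x i - g f i) \<le> h"
      using net[OF x] by blast
    have xf: "x \<in> ell p" "f \<in> ell p" "ell_norm p x \<le> 1" "ell_norm p f \<le> 1"
      using x f F(2) by auto
    define y where "y = x - f"
    have y: "y \<in> ell p" using ell_diff[OF xf(1,2) p] by (simp add: y_def)
    have Ty: "T y = T x - T f" using bdd_ops_apply_diff[OF T xf(1,2) p] by (simp add: y_def)
    have y2: "ell_norm p y \<le> 2"
      using ell_add(2)[OF xf(1) ell_minus(1)[OF xf(2)] p] ell_minus(2)[OF xf(2)] xf(3,4)
      by (simp add: y_def)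
    have yN: "norm (y n) \<le> h" "norm (T y n) \<le> h" if "n < N" for n
      using bspec[OF near, of "(True, n)"] bspec[OF near, of "(False, n)"] that
      by (simp_all add: g_def y_def Ty[unfolded y_def])
    have big: "e \<le> ell_norm q (T y)" using far f Ty by simp
    obtain M0 where M0: "\<And>m. M0 \<le> m \<Longrightarrow> ell_norm p (y - trunc {..<m} y) \<le> h"
      using trunc_tail_small[OF y p h] by blast
    define M1 where "M1 = max N M0"
    define u where "u = trunc {N..<M1} y"
    have u: "u \<in> ell p" and u2: "ell_norm p u \<le> 2"
      using trunc_ell[OF y p, of "{N..<M1}"] y2 by (auto simp: u_def)
    have Tu: "T u \<in> ell q" by (rule bdd_opsD(1)[OF T u])
    have yu: "y - u \<in> ell p" by (rule ell_diff[OF y u p])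
    have "y - u = trunc {..<N} y + (y - trunc {..<M1} y)"
      by (auto simp: u_def trunc_def fun_eq_iff M1_def)
    then have "ell_norm p (y - u) \<le> ell_norm p (trunc {..<N} y) + ell_norm p (y - trunc {..<M1} y)"
      using ell_add(2)[OF trunc_ell(1)[OF y p] ell_diff[OF y trunc_ell(1)[OF y p] p] p] by metis
    also have "\<dots> \<le> real N * h + h"
      using ell_norm_trunc_le[OF p yN(1)] M0[of M1] by (intro add_mono) (auto simp: M1_def)
    finally have yu_le: "ell_norm p (y - u) \<le> (real N + 1) * h" by (simp add: algebra_simps)
    define w where "w = T (y - u)"
    have w: "w \<in> ell q" using bdd_opsD(1)[OF T yu] by (simp add: w_def)
    have w_eq: "T y = T u + w"
      using bdd_ops_apply_diff[OF T y u p] by (simp add: w_def)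
    have w_le: "ell_norm q w \<le> C * ((real N + 1) * h)"
      using Tb[OF yu] mult_left_mono[OF yu_le C] by (simp add: w_def)
    have "T y \<in> ell q" by (rule bdd_opsD(1)[OF T y])
    obtain M2 where M2: "\<And>m. M2 \<le> m \<Longrightarrow> ell_norm q (T u - trunc {..<m} (T u)) \<le> h"
      using trunc_tail_small[OF Tu q h] by blast
    \<comment> \<open>Two cut-off points occur: \<open>M1\<close> determines \<open>u\<close>, and the tail of \<open>T u\<close> that \<open>M2\<close> makes
      small depends on \<open>u\<close>.\<close>
    define M where "M = max (Suc N) (max M1 M2)"
    let ?v = "trunc {N..<M} (T u)"
    let ?head = "trunc {..<N} (T u)" and ?tail = "T u - trunc {..<M} (T u)"
    have v: "?v \<in> ell q" by (rule trunc_ell(1)[OF Tu q])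
    have head: "ell_norm q ?head \<le> real N * h + C * ((real N + 1) * h)"
    proof -
      have "?head = trunc {..<N} (T y) - trunc {..<N} w"
        by (auto simp: trunc_def w_eq)
      then have "ell_norm q ?head \<le> ell_norm q (trunc {..<N} (T y)) + ell_norm q (trunc {..<N} w)"
        using ell_add(2)[OF trunc_ell(1)[OF \<open>T y \<in> ell q\<close> q] ell_minus(1)[OF trunc_ell(1)[OF w q]] q]
          ell_minus(2)[OF trunc_ell(1)[OF w q]] by simp
      also have "\<dots> \<le> real N * h + C * ((real N + 1) * h)"
        using ell_norm_trunc_le[OF q yN(2)] trunc_ell(2)[OF w q, of "{..<N}"] w_le
        by (intro add_mono) auto
      finally show ?thesis .
    qed
    have split: "T u - ?v = ?head + ?tail"
      by (auto simp: trunc_def fun_eq_iff M_def)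
    have "ell_norm q (T u - ?v) \<le> ell_norm q ?head + ell_norm q ?tail"
      unfolding split by (intro ell_add(2) trunc_ell(1) ell_diff Tu q)
    also have "\<dots> \<le> (real N + 1) * (1 + C) * h"
    proof -
      have "M2 \<le> M" by (simp add: M_def)
      then show ?thesis using head M2 by (fastforce simp: algebra_simps)
    qed
    finally have rest: "ell_norm q (T u - ?v) \<le> d' / 2" by (simp only: hd)
    have "e \<le> ell_norm q (T u) + ell_norm q w"
      using big ell_add(2)[OF Tu w q] by (simp add: w_eq)
    moreover have "ell_norm q (T u) \<le> ell_norm q ?v + ell_norm q (T u - ?v)"
      using ell_add(2)[OF v ell_diff[OF Tu v q] q] by simp
    moreover have "ell_norm q w \<le> d' / 2"
    proof -
      have "0 \<le> (real N + 1) * h" using h by simp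
      moreover have "(real N + 1) * h + C * ((real N + 1) * h) = d' / 2"
        using hd by (simp add: algebra_simps)
      ultimately show ?thesis using w_le by linarith
    qed
    ultimately have "e / 2 \<le> ell_norm q ?v" using rest d' by linarith
    moreover have "\<forall>n. n \<notin> {N..<M} \<longrightarrow> u n = 0"
      by (auto simp: u_def trunc_def M_def)
    moreover have "N < M" by (simp add: M_def)
    ultimately show ?thesis
      using u u2 rest d' by (intro exI[of _ M] conjI bexI[of _ u]) auto
  qed
  show thesis using that[of "e / 2"] main e by simp
qed

section \<open>Block operators\<close>

lemma block_sequence_choice:
  fixes P :: "nat \<Rightarrow> nat \<Rightarrow> nat \<Rightarrow> 'b \<Rightarrow> bool"
  assumes "\<And>k N. \<exists>M>N. \<exists>u. P k N M u"
  obtains N u where "strict_mono N" "N 0 = 0" "\<And>k. P k (N k) (N (Suc k)) (u k)"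
proof -
  have "\<forall>k N. \<exists>z. N < fst z \<and> P k N (fst z) (snd z)"
    using assms by simp
  then obtain h where h: "\<And>k N. N < fst (h k N) \<and> P k N (fst (h k N)) (snd (h k N))"
    unfolding choice_iff by blast
  define N where "N = rec_nat 0 (\<lambda>k N. fst (h k N))"
  have N: "N 0 = 0" "\<And>k. N (Suc k) = fst (h k (N k))" by (simp_all add: N_def)
  have "strict_mono N" by (rule strict_monoI_Suc) (simp add: N h)
  then show thesis using that[of N "\<lambda>k. snd (h k (N k))"] N h by simp
qed

lemma sum_blocks:
  fixes f :: "nat \<Rightarrow> 'b::comm_monoid_add"
  assumes "strict_mono N" "N 0 = 0"
  shows "(\<Sum>n<N K. f n) = (\<Sum>k<K. \<Sum>n=N k..<N (Suc k). f n)"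
proof (induction K)
  case (Suc K)
  have "N K \<le> N (Suc K)" using assms(1) by (simp add: strict_mono_less_eq)
  then have "(\<Sum>n<N (Suc K). f n) = (\<Sum>n<N K. f n) + (\<Sum>n=N K..<N (Suc K). f n)"
    by (simp add: lessThan_atLeast0 sum.atLeastLessThan_concat)
  then show ?case by (simp add: Suc)
qed (use assms in simp)

lemma blocks_disjoint:
  fixes N :: "nat \<Rightarrow> nat"
  assumes "strict_mono N" "n \<in> {N j..<N (Suc j)}" "n \<in> {N k..<N (Suc k)}"
  shows "j = k"
proof (rule ccontr)
  assume "j \<noteq> k"
  then consider "Suc j \<le> k" | "Suc k \<le> j" by linarith
  then show False
  proof cases
    case 1
    then have "N (Suc j) \<le> N k" using assms(1) by (simp add: strict_mono_less_eq)
    then show False using assms(2,3) unfolding atLeastLessThan_iff by linarith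
  next
    case 2
    then have "N (Suc k) \<le> N j" using assms(1) by (simp add: strict_mono_less_eq)
    then show False using assms(2,3) unfolding atLeastLessThan_iff by linarith
  qed
qed

text \<open>
  The operator that maps the \<open>k\<close>-th unit vector to \<open>u k\<close>. For consecutive non-empty blocks that start
  at index \<open>0\<close>, the \<open>k\<close>-th block contains no index below \<open>k\<close>, so the terms with \<open>k > n\<close> vanish at \<open>n\<close>
  and a finite sum expresses the whole series.
\<close>

definition block_synthesis :: "real \<Rightarrow> (nat \<Rightarrow> nat \<Rightarrow> 'a::real_normed_field) \<Rightarrow> 'a seq_op" where
  "block_synthesis p u a = (if a \<in> ell p then (\<lambda>n. \<Sum>k\<le>n. a k * u k n) else 0)"

text \<open>
  At an index of the \<open>k\<close>-th block only the term \<open>a k * u k\<close> survives, so the \<open>p\<close>-th power of the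
  norm of the image is the sum of the \<open>p\<close>-th powers of the norms of the \<open>a k * u k\<close>.
\<close>

lemma block_synthesis:
  assumes p: "1 \<le> p" and N: "strict_mono N" "N 0 = 0" and C: "0 \<le> C"
    and u: "\<And>k. u k \<in> ell p" "\<And>k. ell_norm p (u k) \<le> C"
    and supp: "\<And>k n. n \<notin> {N k..<N (Suc k)} \<Longrightarrow> u k n = 0"
  shows "block_synthesis p u \<in> bdd_ops p p"
    and "block_synthesis p u (unit_seq k) = u k"
proof -
  have bnd: "block_synthesis p u a \<in> ell p \<and> ell_norm p (block_synthesis p u a) \<le> C * ell_norm p a"
    if a: "a \<in> ell p" for a
  proof -
    let ?b = "block_synthesis p u a"
    have val: "?b n = a k * u k n" if n: "n \<in> {N k..<N (Suc k)}" for k n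
    proof -
      have "k \<le> n"
        using n strict_mono_imp_increasing[OF N(1), of k] by simp
      moreover have "u j n = 0" if "j \<noteq> k" for j
        using blocks_disjoint[OF N(1) _ n] that supp by blast
      ultimately have "(\<Sum>j\<le>n. a j * u j n) = (\<Sum>j\<in>{k}. a j * u j n)"
        by (intro sum.mono_neutral_right) auto
      then show ?thesis using a by (simp add: block_synthesis_def)
    qed
    have blk: "(\<Sum>n=N k..<N (Suc k). norm (?b n) powr p) \<le> C powr p * norm (a k) powr p" for k
    proof -
      have "(\<Sum>n=N k..<N (Suc k). norm (?b n) powr p)
          = norm (a k) powr p * (\<Sum>n=N k..<N (Suc k). norm (u k n) powr p)"
        by (simp add: val norm_mult powr_mult sum_distrib_left)
      also have "\<dots> \<le> norm (a k) powr p * C powr p"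
      proof (intro mult_left_mono)
        have "(\<Sum>n=N k..<N (Suc k). norm (u k n) powr p) \<le> ell_norm p (u k) powr p"
          by (rule ell_sum_le[OF u(1) p]) simp
        also have "\<dots> \<le> C powr p" using u(2) p by (intro powr_mono2) auto
        finally show "(\<Sum>n=N k..<N (Suc k). norm (u k n) powr p) \<le> C powr p" .
      qed simp
      finally show ?thesis by (simp add: mult.commute)
    qed
    have "(\<Sum>n<N K. norm (?b n) powr p) \<le> (C * ell_norm p a) powr p" for K
    proof -
      have "(\<Sum>n<N K. norm (?b n) powr p) \<le> (\<Sum>k<K. C powr p * norm (a k) powr p)"
        unfolding sum_blocks[OF N] by (intro sum_mono blk)
      also have "\<dots> \<le> C powr p * ell_norm p a powr p"
        using ell_sum_le[OF a p, of "{..<K}"] by (simp add: mult_left_mono flip: sum_distrib_left)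
      finally show ?thesis using C by (simp add: powr_mult)
    qed
    moreover have "m \<le> N m" for m by (rule strict_mono_imp_increasing[OF N(1)])
    ultimately show ?thesis
      using ell_boundedI[OF p, of "C * ell_norm p a" ?b] C by (metis ell_norm_nonneg mult_nonneg_nonneg)
  qed
  show "block_synthesis p u \<in> bdd_ops p p"
  proof (rule bdd_opsI[where C = C])
    fix x y :: "nat \<Rightarrow> 'a" assume xy: "x \<in> ell p" "y \<in> ell p"
    then show "block_synthesis p u (x + y) = block_synthesis p u x + block_synthesis p u y"
      using ell_add(1)[OF xy p]
      by (simp add: block_synthesis_def fun_eq_iff distrib_right sum.distrib)
  next
    fix c and x :: "nat \<Rightarrow> 'a" assume x: "x \<in> ell p"
    then show "block_synthesis p u (\<lambda>n. c * x n) = (\<lambda>n. c * block_synthesis p u x n)"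
      using ell_scale(1)[OF x p]
      by (simp add: block_synthesis_def fun_eq_iff sum_distrib_left mult.assoc)
  qed (use bnd in \<open>auto simp: block_synthesis_def\<close>)
  have "(\<Sum>j\<le>n. unit_seq k j * u j n) = u k n" for n
  proof -
    have "(\<Sum>j\<le>n. unit_seq k j * u j n) = (\<Sum>j\<le>n. if j = k then u k n else 0)"
      by (intro sum.cong) (auto simp: unit_seq_def)
    also have "\<dots> = u k n"
      using supp[of n k] strict_mono_imp_increasing[OF N(1), of k] by auto
    finally show ?thesis .
  qed
  moreover have "unit_seq k \<in> (ell p :: (nat \<Rightarrow> 'a) set)"
    by (rule unit_seq_ell(1)[OF p])
  ultimately show "block_synthesis p u (unit_seq k) = u k"
    by (simp add: block_synthesis_def)
qed

text \<open>
  The coefficients of the functional that takes the value 1 at the restriction of \<open>v\<close> to \<open>S\<close>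
  and has the least possible norm. Writing the phase of \<open>v n\<close> with an inverse instead of a
  conjugate serves real and complex scalars alike; where \<open>v n = 0\<close> the coefficient is \<open>0\<close>,
  since the inverse of \<open>0\<close> is.
\<close>

definition norming_coeff :: "real \<Rightarrow> nat set \<Rightarrow> (nat \<Rightarrow> 'a::real_normed_field) \<Rightarrow> nat \<Rightarrow> 'a" where
  "norming_coeff q S v n =
     inverse (v n) * of_real (norm (v n) powr q / (\<Sum>m\<in>S. norm (v m) powr q))"

text \<open>
  The numbers \<open>norm (v n) powr q / ?w\<close> are weights with sum 1, and the functional is bounded by the
  weighted mean of the quotients \<open>norm (z n) / norm (v n)\<close>. The norm estimate is
  Jensen's inequality for this mean.
\<close>

lemma norming_coeff:
  fixes v :: "nat \<Rightarrow> 'a::real_normed_field"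
  assumes q: "1 \<le> q" and S: "finite S" and pos: "0 < (\<Sum>m\<in>S. norm (v m) powr q)" (is "0 < ?w")
  shows "(\<Sum>n\<in>S. norming_coeff q S v n * v n) = 1"
    and "norm (\<Sum>n\<in>S. norming_coeff q S v n * z n) powr q \<le> (\<Sum>n\<in>S. norm (z n) powr q) / ?w"
proof -
  have wt1: "(\<Sum>n\<in>S. norm (v n) powr q / ?w) = 1"
    using pos by (simp flip: sum_divide_distrib)
  have "(\<Sum>n\<in>S. norming_coeff q S v n * v n) = (\<Sum>n\<in>S. of_real (norm (v n) powr q / ?w))"
  proof (intro sum.cong refl)
    fix n
    show "norming_coeff q S v n * v n = of_real (norm (v n) powr q / ?w)"
      by (cases "v n = 0") (simp_all add: norming_coeff_def field_simps)
  qed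
  also have "\<dots> = 1" using wt1 by (metis of_real_1 of_real_sum)
  finally show "(\<Sum>n\<in>S. norming_coeff q S v n * v n) = 1" .
  have cvx: "convex_on {0..} (\<lambda>x::real. x powr q)"
  proof (rule convex_onI)
    fix t x y :: real assume t: "0 < t" "t < 1" "x \<in> {0..}" "y \<in> {0..}"
    then show "((1 - t) *\<^sub>R x + t *\<^sub>R y) powr q \<le> (1 - t) * x powr q + t * y powr q"
      using powr_convex_nonneg[OF q, of x y "1 - t" t] by simp
  qed simp
  have "S \<noteq> {}" using pos by auto
  have "norm (\<Sum>n\<in>S. norming_coeff q S v n * z n)
      \<le> (\<Sum>n\<in>S. (norm (v n) powr q / ?w) * (norm (z n) / norm (v n)))"
    using pos by (intro sum_norm_le) (simp add: norming_coeff_def norm_mult norm_inverse divide_inverse del: of_real_divide of_real_mult of_real_sum)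
  then have "norm (\<Sum>n\<in>S. norming_coeff q S v n * z n) powr q
      \<le> (\<Sum>n\<in>S. (norm (v n) powr q / ?w) * (norm (z n) / norm (v n))) powr q"
    using q by (intro powr_mono2) auto
  also have "\<dots> \<le> (\<Sum>n\<in>S. (norm (v n) powr q / ?w) * (norm (z n) / norm (v n)) powr q)"
    using convex_on_sum[OF S \<open>S \<noteq> {}\<close> cvx wt1, of "\<lambda>n. norm (z n) / norm (v n)"] pos by simp
  also have "\<dots> \<le> (\<Sum>n\<in>S. norm (z n) powr q / ?w)"
    using pos by (intro sum_mono) (auto simp: powr_divide divide_simps)
  finally show "norm (\<Sum>n\<in>S. norming_coeff q S v n * z n) powr q \<le> (\<Sum>n\<in>S. norm (z n) powr q) / ?w"
    by (simp add: sum_divide_distrib)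
qed

text \<open>
  The left inverse of a synthesis: the \<open>k\<close>-th coordinate of the image is the value of the
  functional that norms \<open>v k\<close> on the \<open>k\<close>-th block.
\<close>

definition block_analysis ::
    "real \<Rightarrow> (nat \<Rightarrow> nat) \<Rightarrow> (nat \<Rightarrow> nat \<Rightarrow> 'a::real_normed_field) \<Rightarrow> 'a seq_op" where
  "block_analysis q N v z =
     (if z \<in> ell q
      then (\<lambda>k. \<Sum>n=N k..<N (Suc k). norming_coeff q {N k..<N (Suc k)} (v k) n * z n) else 0)"

text \<open>
  The \<open>k\<close>-th functional has norm at most \<open>1 / e\<close> and sees only the \<open>k\<close>-th block of \<open>z\<close>. Since the
  blocks are disjoint, the \<open>q\<close>-th powers of its values add up to at most that of the norm of \<open>z\<close>,
  up to the constant.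
\<close>

lemma block_analysis:
  assumes q: "1 \<le> q" and N: "strict_mono N" "N 0 = 0" and e: "0 < e"
    and v: "\<And>k. e \<le> ell_norm q (trunc {N k..<N (Suc k)} (v k))"
  shows "block_analysis q N v \<in> bdd_ops q q"
    and "z \<in> ell q \<Longrightarrow> ell_norm q (block_analysis q N v z) \<le> ell_norm q z / e"
    and "block_analysis q N v (trunc {N k..<N (Suc k)} (v k)) = unit_seq k"
proof -
  let ?S = "\<lambda>k. {N k..<N (Suc k)}"
  let ?w = "\<lambda>k. \<Sum>n\<in>?S k. norm (v k n) powr q"
  have w: "e powr q \<le> ?w k" for k
    using trunc_finite_ell(2)[of "?S k" q "v k"] powr_mono2[OF _ _ v, of q k] q e by simp
  have w0: "0 < ?w k" for k
    by (rule less_le_trans[OF _ w]) (use e in simp)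
  have bnd: "block_analysis q N v z \<in> ell q \<and> ell_norm q (block_analysis q N v z) \<le> ell_norm q z / e"
    if z: "z \<in> ell q" for z
  proof -
    let ?b = "block_analysis q N v z"
    have blk: "norm (?b k) powr q \<le> (\<Sum>n\<in>?S k. norm (z n) powr q) / e powr q" for k
    proof -
      have "norm (?b k) powr q \<le> (\<Sum>n\<in>?S k. norm (z n) powr q) / ?w k"
        using norming_coeff(2)[OF q _ w0, of k z] z by (simp add: block_analysis_def)
      also have "\<dots> \<le> (\<Sum>n\<in>?S k. norm (z n) powr q) / e powr q"
        using w[of k] e by (intro divide_left_mono sum_nonneg mult_pos_pos w0) auto
      finally show ?thesis .
    qed
    have "(\<Sum>k<K. norm (?b k) powr q) \<le> (ell_norm q z / e) powr q" for K
    proof -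
      have "(\<Sum>k<K. norm (?b k) powr q) \<le> (\<Sum>k<K. (\<Sum>n\<in>?S k. norm (z n) powr q) / e powr q)"
        by (intro sum_mono blk)
      also have "\<dots> = (\<Sum>n<N K. norm (z n) powr q) / e powr q"
        by (simp add: sum_blocks[OF N] sum_divide_distrib)
      also have "\<dots> \<le> ell_norm q z powr q / e powr q"
        using ell_sum_le[OF z q] by (intro divide_right_mono) auto
      finally show ?thesis using e by (simp add: powr_divide)
    qed
    then show ?thesis
      using ell_boundedI[OF q, of "ell_norm q z / e" ?b] e by (metis divide_nonneg_pos ell_norm_nonneg order_refl)
  qed
  show "z \<in> ell q \<Longrightarrow> ell_norm q (block_analysis q N v z) \<le> ell_norm q z / e"
    using bnd by blast
  show "block_analysis q N v \<in> bdd_ops q q"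
  proof (rule bdd_opsI[where C = "1 / e"])
    fix x y :: "nat \<Rightarrow> 'a" assume xy: "x \<in> ell q" "y \<in> ell q"
    then show "block_analysis q N v (x + y) = block_analysis q N v x + block_analysis q N v y"
      using ell_add(1)[OF xy q]
      by (simp add: block_analysis_def fun_eq_iff distrib_left sum.distrib)
  next
    fix c and x :: "nat \<Rightarrow> 'a" assume x: "x \<in> ell q"
    then show "block_analysis q N v (\<lambda>n. c * x n) = (\<lambda>n. c * block_analysis q N v x n)"
      using ell_scale(1)[OF x q]
      by (simp add: block_analysis_def fun_eq_iff sum_distrib_left mult.left_commute)
  qed (use bnd in \<open>auto simp: block_analysis_def\<close>)
  let ?t = "trunc (?S k) (v k)"
  have "?t \<in> ell q" by (rule trunc_finite_ell(1)[OF _ q]) simp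
  moreover have "(\<Sum>n\<in>?S j. norming_coeff q (?S j) (v j) n * ?t n) = unit_seq k j" for j
  proof (cases "j = k")
    case True
    have "(\<Sum>n\<in>?S k. norming_coeff q (?S k) (v k) n * ?t n) = (\<Sum>n\<in>?S k. norming_coeff q (?S k) (v k) n * v k n)"
      by (intro sum.cong) (auto simp: trunc_def)
    then show ?thesis
      using norming_coeff(1)[OF q _ w0, of k] True by (simp add: unit_seq_def)
  next
    case False
    then have "?t n = 0" if "n \<in> ?S j" for n
      using blocks_disjoint[OF N(1) that, of k] by (auto simp: trunc_def)
    then show ?thesis using False by (simp add: unit_seq_def)
  qed
  ultimately show "block_analysis q N v ?t = unit_seq k"
    by (simp add: block_analysis_def fun_eq_iff)
qed

section \<open>Approximate factorization of the formal identity\<close>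

text \<open>
  With \<open>B\<close> the synthesis of the localized vectors \<open>u k\<close> and \<open>A\<close> the analysis for their images,
  the defect at the \<open>k\<close>-th unit vector is the image under \<open>A\<close> of the part of \<open>T (u k)\<close> outside
  the \<open>k\<close>-th block. The norm of \<open>A\<close> is at most \<open>1 / e\<close> whatever the vectors are, so the size of
  that part can be fixed in advance.
\<close>

lemma noncompact_op_factors_approx:
  fixes T :: "'a::{real_normed_field, euclidean_space} seq_op"
  assumes p: "1 \<le> p" and pq: "p \<le> q" and T: "T \<in> bdd_ops p q" and nc: "\<not> compact_op p q T"
    and r: "0 < r"
  obtains A B where "A \<in> bdd_ops q q" "B \<in> bdd_ops p p"
    "op_norm p q (formal_identity p - (A \<circ> T \<circ> B)) \<le> r"
proof -
  have q: "1 \<le> q" using p pq by simp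
  obtain e where e: "0 < e"
    and loc: "\<And>N d. 0 < d \<Longrightarrow> \<exists>M>N. \<exists>u\<in>ell p. ell_norm p u \<le> 2 \<and>
      (\<forall>n. n \<notin> {N..<M} \<longrightarrow> u n = 0) \<and> e \<le> ell_norm q (trunc {N..<M} (T u)) \<and>
      ell_norm q (T u - trunc {N..<M} (T u)) \<le> d"
    using noncompact_op_localized[OF p q T nc] by blast
  \<comment> \<open>A positive sequence with sum \<open>r\<close>; the factor \<open>e\<close> below absorbs the norm of \<open>A\<close>.\<close>
  define d where "d k = r * (1 / 2) ^ Suc k" for k
  have d: "0 < e * d k" for k using r e by (simp add: d_def)
  have dsum: "(\<Sum>k<K. d k) \<le> r" for K
  proof -
    have "(\<Sum>k<K. d k) = r * (1 - (1 / 2) ^ K)"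
      by (induction K) (auto simp: d_def algebra_simps)
    then show ?thesis using r by (simp add: mult_le_cancel_left1)
  qed
  define P where "P k N M u \<longleftrightarrow> u \<in> ell p \<and> ell_norm p u \<le> 2 \<and>
      (\<forall>n. n \<notin> {N..<M} \<longrightarrow> u n = 0) \<and> e \<le> ell_norm q (trunc {N..<M} (T u)) \<and>
      ell_norm q (T u - trunc {N..<M} (T u)) \<le> e * d k" for k N M and u :: "nat \<Rightarrow> 'a"
  have "\<exists>M>N. \<exists>u. P k N M u" for k N
    using loc[OF d[of k], of N] unfolding P_def Bex_def .
  then obtain N u where N: "strict_mono N" "N 0 = 0" and P: "\<And>k. P k (N k) (N (Suc k)) (u k)"
    by (rule block_sequence_choice) (rule that)
  note u = P[unfolded P_def]
  let ?v = "\<lambda>k. trunc {N k..<N (Suc k)} (T (u k))"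
  define A where "A = block_analysis q N (\<lambda>k. T (u k))"
  define B where "B = block_synthesis p u"
  have A: "A \<in> bdd_ops q q" "\<And>z. z \<in> ell q \<Longrightarrow> ell_norm q (A z) \<le> ell_norm q z / e"
    "\<And>k. A (?v k) = unit_seq k"
    unfolding A_def using block_analysis[OF q N e, of "\<lambda>k. T (u k)"] u by simp_all
  have B: "B \<in> bdd_ops p p" "\<And>k. B (unit_seq k) = u k"
    unfolding B_def using block_synthesis[OF p N, of 2 u] u by simp_all
  let ?D = "formal_identity p - (A \<circ> T \<circ> B)"
  have "A \<circ> T \<circ> B \<in> bdd_ops p q"
    by (intro bdd_ops_comp[OF _ B(1)] bdd_ops_comp[OF A(1) T])
  then have D: "?D \<in> bdd_ops p q"
    by (rule bdd_ops_diff[OF formal_identity_bdd_ops[OF p pq] _ q])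
  have "ell_norm q (?D (unit_seq k)) \<le> d k" for k
  proof -
    have Tu: "T (u k) \<in> ell q" using bdd_opsD(1)[OF T] u by blast
    have v: "?v k \<in> ell q" by (rule trunc_ell(1)[OF Tu q])
    have "?D (unit_seq k) = A (?v k) - A (T (u k))"
      using unit_seq_ell(1)[OF p, of k, where 'a = 'a] by (simp add: formal_identity_def A(3) B(2))
    also have "\<dots> = A (?v k - T (u k))"
      by (rule bdd_ops_apply_diff[OF A(1) v Tu q, symmetric])
    finally have "ell_norm q (?D (unit_seq k)) \<le> ell_norm q (?v k - T (u k)) / e"
      using A(2)[OF ell_diff[OF v Tu q]] by simp
    also have "\<dots> \<le> e * d k / e"
      using u[of k] e by (intro divide_right_mono) (auto simp: ell_norm_minus_commute[of q "?v k"])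
    finally show ?thesis using e by simp
  qed
  then have "op_norm p q ?D \<le> r"
    by (rule op_norm_le_unit_seqs[OF p q D _ dsum])
  with A(1) B(1) show thesis by (rule that)
qed

theorem corollary3p2:
  fixes p q :: real
    and J :: "'a::{real_normed_field, euclidean_space} seq_op set"
  assumes "1 \<le> p" and "p < q"
    and "closed_op_ideal p q J"
    and "\<exists>T\<in>J. \<not> compact_op p q T"
  shows "closed_ideal_generated p q (formal_identity p) \<subseteq> J"
proof -
  have p: "1 \<le> p" and q: "1 \<le> q" and pq: "p \<le> q" using assms(1,2) by auto
  obtain T where T: "T \<in> J" "\<not> compact_op p q T" using assms(4) by blast
  have J: "J \<subseteq> bdd_ops p q" "\<And>A B. A \<in> bdd_ops q q \<Longrightarrow> B \<in> bdd_ops p p \<Longrightarrow> A \<circ> T \<circ> B \<in> J"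
    using assms(3) T(1) by (auto simp: closed_op_ideal_def op_ideal_def)
  interpret Metric_space "bdd_ops p q :: 'a seq_op set" "\<lambda>S T. op_norm p q (S - T)"
    by (rule Metric_space_bdd_ops[OF p q])
  have "closedin mtopology J"
    using assms(3) by (simp add: closed_op_ideal_def op_topology_def)
  then have clos: "mtopology closure_of J = J" by (rule closure_of_closedin)
  have I: "formal_identity p \<in> (bdd_ops p q :: 'a seq_op set)"
    by (rule formal_identity_bdd_ops[OF p pq])
  have "\<exists>S\<in>J. S \<in> mball (formal_identity p) r" if "0 < r" for r
  proof -
    have "T \<in> bdd_ops p q" "0 < r / 2" using J(1) T(1) that by auto
    then obtain A B where "A \<in> bdd_ops q q" "B \<in> bdd_ops p p"
      and le: "op_norm p q (formal_identity p - (A \<circ> T \<circ> B)) \<le> r / 2"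
      by (rule noncompact_op_factors_approx[OF p pq _ T(2)])
    then have "A \<circ> T \<circ> B \<in> J" by (intro J(2))
    moreover from this have "A \<circ> T \<circ> B \<in> mball (formal_identity p) r"
      using I J(1) le that by auto
    ultimately show ?thesis by blast
  qed
  then have "formal_identity p \<in> mtopology closure_of J"
    using I by (simp add: metric_closure_of)
  then have "formal_identity p \<in> J" by (simp add: clos)
  then show ?thesis
    unfolding closed_ideal_generated_def by (intro hull_minimal) (simp_all add: assms(3))
qed

end
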